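(* Let $n\in\mathbb{N}$, let $\mathbf{k}$ be a commutative ring, and let $i,j\in\{1,2,\ldots,n\}$. Then, in $\mathbf{k}[S_n]$, $$[t_i,t_j]^{\lceil (n-j)/2\rceil+1}=0,$$ where $\lceil x\rceil$ denotes the smallest integer that is $\geq x$.
   Context: Here $\mathbb{N}=\{0,1,2,\ldots\}$, and $[m]:=\{1,2,\ldots,m\}$. $S_n$ is the symmetric group on $[n]$, with product $(\pi\sigma)(i)=\pi(\sigma(i))$, viewed as a subset of the group algebra $\mathbf{k}[S_n]$. For distinct $i_1,\ldots,i_k\in[n]$, $\operatorname{cyc}_{i_1,\ldots,i_k}\in S_n$ is the cycle sending $i_1\mapsto i_2\mapsto\cdots\mapsto i_k\mapsto i_1$ and fixing all other elements (so $\operatorname{cyc}_i=\operatorname{id}=1$). For each $\ell\in[n]$, the somewhere-to-below shuffle is $t_\ell:=\operatorname{cyc}_{\ell}+\operatorname{cyc}_{\ell,\ell+1}+\operatorname{cyc}_{\ell,\ell+1,\ell+2}+\cdots+\operatorname{cyc}_{\ell,\ell+1,\ldots,n}\in\mathbf{k}[S_n]$. For elements $a,b$ of a ring, $[a,b]:=ab-ba$ is the commutator. *)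

theory Defs
  imports Complex_Main "HOL-Algebra.Ring" "HOL-Algebra.Sym_Groups"
begin

text \<open>
  The group algebra \<open>R[G]\<close> of a finite group \<open>G\<close>, as a ring: an element is the family of its
  coefficients, extended by \<open>undefined\<close> outside \<open>carrier G\<close>. Finiteness of \<open>G\<close> matters: there is
  no support condition, and \<open>finsum\<close> over an infinite set is \<open>\<zero>\<close>.
\<close>

definition group_ring :: "('k, 'r) ring_scheme \<Rightarrow> ('g, 'm) monoid_scheme \<Rightarrow> ('g \<Rightarrow> 'k) ring"
  where "group_ring R G =
    \<lparr> carrier = carrier G \<rightarrow>\<^sub>E carrier R,
      monoid.mult = (\<lambda>a b. \<lambda>g\<in>carrier G. \<Oplus>\<^bsub>R\<^esub>h\<in>carrier G. a h \<otimes>\<^bsub>R\<^esub> b (inv\<^bsub>G\<^esub> h \<otimes>\<^bsub>G\<^esub> g)),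
      one = (\<lambda>g\<in>carrier G. if g = \<one>\<^bsub>G\<^esub> then \<one>\<^bsub>R\<^esub> else \<zero>\<^bsub>R\<^esub>),
      zero = (\<lambda>g\<in>carrier G. \<zero>\<^bsub>R\<^esub>),
      add = (\<lambda>a b. \<lambda>g\<in>carrier G. a g \<oplus>\<^bsub>R\<^esub> b g) \<rparr>"

lemma (in abelian_monoid) finsum_swap:
  assumes "finite A" "finite B" "\<And>x y. x \<in> A \<Longrightarrow> y \<in> B \<Longrightarrow> f x y \<in> carrier G"
  shows "(\<Oplus>x\<in>A. \<Oplus>y\<in>B. f x y) = (\<Oplus>y\<in>B. \<Oplus>x\<in>A. f x y)"
  using assms(1,3)
proof (induction A rule: finite_induct)
  case empty
  then show ?case by (simp add: finsum_zero)
next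
  case (insert a A)
  have "(\<Oplus>x\<in>insert a A. \<Oplus>y\<in>B. f x y) = (\<Oplus>y\<in>B. f a y) \<oplus> (\<Oplus>y\<in>B. \<Oplus>x\<in>A. f x y)"
    using insert by (subst finsum_insert) (auto intro!: finsum_closed)
  also have "\<dots> = (\<Oplus>y\<in>B. f a y \<oplus> (\<Oplus>x\<in>A. f x y))"
    using insert by (subst finsum_addf) (auto intro!: finsum_closed)
  also have "\<dots> = (\<Oplus>y\<in>B. \<Oplus>x\<in>insert a A. f x y)"
    using insert by (intro finsum_cong') (auto intro!: finsum_closed)
  finally show ?case .
qed

lemma ring_group_ring:
  assumes R: "ring R" and G: "group G" and fin: "finite (carrier G)"
  shows "ring (group_ring R G)"
proof -
  interpret R: ring R by fact
  interpret G: group G by fact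
  let ?A = "group_ring R G"
  have cl: "a g \<in> carrier R" if "a \<in> carrier ?A" "g \<in> carrier G" for a g
    using that by (auto simp: group_ring_def)
  have ext: "a = b" if "a \<in> carrier ?A" "b \<in> carrier ?A" "\<And>g. g \<in> carrier G \<Longrightarrow> a g = b g" for a b
    using that by (auto simp: group_ring_def intro: PiE_ext)
  have add: "(a \<oplus>\<^bsub>?A\<^esub> b) g = a g \<oplus>\<^bsub>R\<^esub> b g" if "g \<in> carrier G" for a b g
    using that by (simp add: group_ring_def)
  have mul: "(a \<otimes>\<^bsub>?A\<^esub> b) g = (\<Oplus>\<^bsub>R\<^esub>h\<in>carrier G. a h \<otimes>\<^bsub>R\<^esub> b (inv\<^bsub>G\<^esub> h \<otimes>\<^bsub>G\<^esub> g))" if "g \<in> carrier G" for a b g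
    using that by (simp add: group_ring_def)
  have zero: "\<zero>\<^bsub>?A\<^esub> g = \<zero>\<^bsub>R\<^esub>" if "g \<in> carrier G" for g
    using that by (simp add: group_ring_def)
  have one: "\<one>\<^bsub>?A\<^esub> g = (if g = \<one>\<^bsub>G\<^esub> then \<one>\<^bsub>R\<^esub> else \<zero>\<^bsub>R\<^esub>)" if "g \<in> carrier G" for g
    using that by (simp add: group_ring_def)
  have addc: "a \<oplus>\<^bsub>?A\<^esub> b \<in> carrier ?A" if "a \<in> carrier ?A" "b \<in> carrier ?A" for a b
    using that by (auto simp: group_ring_def PiE_def Pi_def extensional_def)
  have mulc: "a \<otimes>\<^bsub>?A\<^esub> b \<in> carrier ?A" if "a \<in> carrier ?A" "b \<in> carrier ?A" for a b
    using that cl[OF that(1)] cl[OF that(2)]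
    by (auto simp: group_ring_def intro!: R.finsum_closed R.m_closed)
  have zeroc: "\<zero>\<^bsub>?A\<^esub> \<in> carrier ?A" by (auto simp: group_ring_def)
  have onec: "\<one>\<^bsub>?A\<^esub> \<in> carrier ?A" by (auto simp: group_ring_def)
  show ?thesis
  proof (rule ringI)
    show "abelian_group ?A"
    proof (rule abelian_groupI)
      fix a assume a: "a \<in> carrier ?A"
      define b where "b = (\<lambda>g\<in>carrier G. \<ominus>\<^bsub>R\<^esub> a g)"
      have b: "b \<in> carrier ?A" using a cl[OF a] by (auto simp: b_def group_ring_def)
      have "b \<oplus>\<^bsub>?A\<^esub> a = \<zero>\<^bsub>?A\<^esub>"
        by (rule ext) (use a b cl in \<open>auto simp: add zero addc zeroc b_def R.l_neg\<close>)
      then show "\<exists>b\<in>carrier ?A. b \<oplus>\<^bsub>?A\<^esub> a = \<zero>\<^bsub>?A\<^esub>" using b by blast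
    qed (auto intro!: ext simp: addc zeroc add zero cl R.a_ac)
  next
    show "Group.monoid ?A"
    proof (rule monoidI)
      fix a b c assume abc: "a \<in> carrier ?A" "b \<in> carrier ?A" "c \<in> carrier ?A"
      show "a \<otimes>\<^bsub>?A\<^esub> b \<otimes>\<^bsub>?A\<^esub> c = a \<otimes>\<^bsub>?A\<^esub> (b \<otimes>\<^bsub>?A\<^esub> c)"
      proof (rule ext)
        fix g assume g: "g \<in> carrier G"
        have "(a \<otimes>\<^bsub>?A\<^esub> b \<otimes>\<^bsub>?A\<^esub> c) g = (\<Oplus>\<^bsub>R\<^esub>h\<in>carrier G. \<Oplus>\<^bsub>R\<^esub>k\<in>carrier G.
            a k \<otimes>\<^bsub>R\<^esub> b (inv\<^bsub>G\<^esub> k \<otimes>\<^bsub>G\<^esub> h) \<otimes>\<^bsub>R\<^esub> c (inv\<^bsub>G\<^esub> h \<otimes>\<^bsub>G\<^esub> g))"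
          unfolding mul[OF g] using abc g fin
          by (intro R.finsum_cong') (auto simp: mul cl mulc intro!: R.finsum_ldistr R.finsum_closed)
        also have "\<dots> = (\<Oplus>\<^bsub>R\<^esub>k\<in>carrier G. \<Oplus>\<^bsub>R\<^esub>h\<in>carrier G.
            a k \<otimes>\<^bsub>R\<^esub> b (inv\<^bsub>G\<^esub> k \<otimes>\<^bsub>G\<^esub> h) \<otimes>\<^bsub>R\<^esub> c (inv\<^bsub>G\<^esub> h \<otimes>\<^bsub>G\<^esub> g))"
          using fin abc g by (intro R.finsum_swap) (auto simp: cl)
        also have "\<dots> = (\<Oplus>\<^bsub>R\<^esub>k\<in>carrier G. a k \<otimes>\<^bsub>R\<^esub> (b \<otimes>\<^bsub>?A\<^esub> c) (inv\<^bsub>G\<^esub> k \<otimes>\<^bsub>G\<^esub> g))"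
        proof (rule R.finsum_cong')
          fix k assume k: "k \<in> carrier G"
          have im: "(\<lambda>h. k \<otimes>\<^bsub>G\<^esub> h) ` carrier G = carrier G"
            using k by (rule G.surj_const_mult)
          have inj: "inj_on (\<lambda>h. k \<otimes>\<^bsub>G\<^esub> h) (carrier G)"
            using k by (rule G.inj_on_cmult)
          have "(\<Oplus>\<^bsub>R\<^esub>h\<in>carrier G. a k \<otimes>\<^bsub>R\<^esub> b (inv\<^bsub>G\<^esub> k \<otimes>\<^bsub>G\<^esub> h) \<otimes>\<^bsub>R\<^esub> c (inv\<^bsub>G\<^esub> h \<otimes>\<^bsub>G\<^esub> g)) =
             (\<Oplus>\<^bsub>R\<^esub>h\<in>carrier G. a k \<otimes>\<^bsub>R\<^esub> b (inv\<^bsub>G\<^esub> k \<otimes>\<^bsub>G\<^esub> (k \<otimes>\<^bsub>G\<^esub> h)) \<otimes>\<^bsub>R\<^esub> c (inv\<^bsub>G\<^esub> (k \<otimes>\<^bsub>G\<^esub> h) \<otimes>\<^bsub>G\<^esub> g))"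
            using R.finsum_reindex[OF _ inj, of "\<lambda>h. a k \<otimes>\<^bsub>R\<^esub> b (inv\<^bsub>G\<^esub> k \<otimes>\<^bsub>G\<^esub> h) \<otimes>\<^bsub>R\<^esub> c (inv\<^bsub>G\<^esub> h \<otimes>\<^bsub>G\<^esub> g)"]
              abc g k unfolding im by (auto simp: cl)
          also have "\<dots> = (\<Oplus>\<^bsub>R\<^esub>h\<in>carrier G. a k \<otimes>\<^bsub>R\<^esub> (b h \<otimes>\<^bsub>R\<^esub> c (inv\<^bsub>G\<^esub> h \<otimes>\<^bsub>G\<^esub> (inv\<^bsub>G\<^esub> k \<otimes>\<^bsub>G\<^esub> g))))"
            using abc g k
            by (intro R.finsum_cong') (auto simp: cl G.inv_mult_group G.m_assoc R.m_assoc G.m_assoc[symmetric, of "inv\<^bsub>G\<^esub> k" k])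
          also have "\<dots> = a k \<otimes>\<^bsub>R\<^esub> (b \<otimes>\<^bsub>?A\<^esub> c) (inv\<^bsub>G\<^esub> k \<otimes>\<^bsub>G\<^esub> g)"
            using abc g k fin by (simp add: mul, subst R.finsum_rdistr) (auto simp: cl)
          finally show "(\<Oplus>\<^bsub>R\<^esub>h\<in>carrier G. a k \<otimes>\<^bsub>R\<^esub> b (inv\<^bsub>G\<^esub> k \<otimes>\<^bsub>G\<^esub> h) \<otimes>\<^bsub>R\<^esub> c (inv\<^bsub>G\<^esub> h \<otimes>\<^bsub>G\<^esub> g)) =
            a k \<otimes>\<^bsub>R\<^esub> (b \<otimes>\<^bsub>?A\<^esub> c) (inv\<^bsub>G\<^esub> k \<otimes>\<^bsub>G\<^esub> g)" .
        qed (use abc g in \<open>auto simp: cl mulc\<close>)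
        finally show "(a \<otimes>\<^bsub>?A\<^esub> b \<otimes>\<^bsub>?A\<^esub> c) g = (a \<otimes>\<^bsub>?A\<^esub> (b \<otimes>\<^bsub>?A\<^esub> c)) g"
          by (simp add: mul[OF g])
      qed (use abc in \<open>auto simp: mulc\<close>)
    next
      fix a assume a: "a \<in> carrier ?A"
      show "\<one>\<^bsub>?A\<^esub> \<otimes>\<^bsub>?A\<^esub> a = a"
      proof (rule ext)
        fix g assume g: "g \<in> carrier G"
        have "(\<one>\<^bsub>?A\<^esub> \<otimes>\<^bsub>?A\<^esub> a) g = (\<Oplus>\<^bsub>R\<^esub>h\<in>carrier G. if \<one>\<^bsub>G\<^esub> = h then a (inv\<^bsub>G\<^esub> h \<otimes>\<^bsub>G\<^esub> g) else \<zero>\<^bsub>R\<^esub>)"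
          unfolding mul[OF g] using a g by (intro R.finsum_cong') (auto simp: one cl)
        also have "\<dots> = a g"
          using a g fin by (subst R.add.finprod_singleton) (auto simp: cl)
        finally show "(\<one>\<^bsub>?A\<^esub> \<otimes>\<^bsub>?A\<^esub> a) g = a g" .
      qed (use a in \<open>auto simp: mulc onec\<close>)
      show "a \<otimes>\<^bsub>?A\<^esub> \<one>\<^bsub>?A\<^esub> = a"
      proof (rule ext)
        fix g assume g: "g \<in> carrier G"
        have eq: "inv\<^bsub>G\<^esub> h \<otimes>\<^bsub>G\<^esub> g = \<one>\<^bsub>G\<^esub> \<longleftrightarrow> g = h" if "h \<in> carrier G" for h
          using that g by (metis G.inv_closed G.inv_equality G.inv_inv G.l_inv)
        have "(a \<otimes>\<^bsub>?A\<^esub> \<one>\<^bsub>?A\<^esub>) g = (\<Oplus>\<^bsub>R\<^esub>h\<in>carrier G. if g = h then a h else \<zero>\<^bsub>R\<^esub>)"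
          unfolding mul[OF g] using a g by (intro R.finsum_cong') (auto simp: one cl eq)
        also have "\<dots> = a g"
          using a g fin by (subst R.add.finprod_singleton) (auto simp: cl)
        finally show "(a \<otimes>\<^bsub>?A\<^esub> \<one>\<^bsub>?A\<^esub>) g = a g" .
      qed (use a in \<open>auto simp: mulc onec\<close>)
    qed (auto simp: mulc onec)
  next
    fix a b c assume abc: "a \<in> carrier ?A" "b \<in> carrier ?A" "c \<in> carrier ?A"
    show "(a \<oplus>\<^bsub>?A\<^esub> b) \<otimes>\<^bsub>?A\<^esub> c = a \<otimes>\<^bsub>?A\<^esub> c \<oplus>\<^bsub>?A\<^esub> b \<otimes>\<^bsub>?A\<^esub> c"
    proof (rule ext)
      fix g assume g: "g \<in> carrier G"
      show "((a \<oplus>\<^bsub>?A\<^esub> b) \<otimes>\<^bsub>?A\<^esub> c) g = (a \<otimes>\<^bsub>?A\<^esub> c \<oplus>\<^bsub>?A\<^esub> b \<otimes>\<^bsub>?A\<^esub> c) g"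
        unfolding mul[OF g] add[OF g] using abc g
        by (subst R.finsum_addf[symmetric]) (auto simp: cl add R.l_distr simp del: R.finsum_addf intro!: R.finsum_cong')
    qed (use abc in \<open>auto simp: mulc addc\<close>)
    show "c \<otimes>\<^bsub>?A\<^esub> (a \<oplus>\<^bsub>?A\<^esub> b) = c \<otimes>\<^bsub>?A\<^esub> a \<oplus>\<^bsub>?A\<^esub> c \<otimes>\<^bsub>?A\<^esub> b"
    proof (rule ext)
      fix g assume g: "g \<in> carrier G"
      show "(c \<otimes>\<^bsub>?A\<^esub> (a \<oplus>\<^bsub>?A\<^esub> b)) g = (c \<otimes>\<^bsub>?A\<^esub> a \<oplus>\<^bsub>?A\<^esub> c \<otimes>\<^bsub>?A\<^esub> b) g"
        unfolding mul[OF g] add[OF g] using abc g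
        by (subst R.finsum_addf[symmetric]) (auto simp: cl add R.r_distr simp del: R.finsum_addf intro!: R.finsum_cong')
    qed (use abc in \<open>auto simp: mulc addc\<close>)
  qed
qed

text \<open>The canonical map from \<open>G\<close> to \<open>R[G]\<close>.\<close>

definition group_ring_of ::
    "('k, 'r) ring_scheme \<Rightarrow> ('g, 'm) monoid_scheme \<Rightarrow> 'g \<Rightarrow> ('g \<Rightarrow> 'k)"
  where "group_ring_of R G x = (\<lambda>g\<in>carrier G. if g = x then \<one>\<^bsub>R\<^esub> else \<zero>\<^bsub>R\<^esub>)"

text \<open>\<open>cycle_of_list [l..<Suc m]\<close> is the cycle \<open>l \<mapsto> l + 1 \<mapsto> \<dots> \<mapsto> m \<mapsto> l\<close>.\<close>

definition somewhere_to_below ::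
    "('k, 'r) ring_scheme \<Rightarrow> nat \<Rightarrow> nat \<Rightarrow> ((nat \<Rightarrow> nat) \<Rightarrow> 'k)"
  where "somewhere_to_below R n l =
    (\<Oplus>\<^bsub>group_ring R (sym_group n)\<^esub>m\<in>{l..n}.
       group_ring_of R (sym_group n) (cycle_of_list [l..<Suc m]))"

definition ring_commutator :: "('a, 'r) ring_scheme \<Rightarrow> 'a \<Rightarrow> 'a \<Rightarrow> 'a"
  where "ring_commutator R a b = (a \<otimes>\<^bsub>R\<^esub> b) \<ominus>\<^bsub>R\<^esub> (b \<otimes>\<^bsub>R\<^esub> a)"

end

theory Submission
  imports Defs
begin

text \<open>
  With \<open>s\<^sub>p\<close> the simple transpositions, \<open>t\<^sub>n = 1\<close> and \<open>t\<^sub>p = 1 + s\<^sub>p t\<^sub>p\<^sub>+\<^sub>1\<close>; these relations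
  together with the Coxeter relations suffice. They give \<open>s\<^sub>p t\<^sub>p\<^sub>+\<^sub>1 t\<^sub>p = t\<^sub>p\<^sub>+\<^sub>1 t\<^sub>p\<close>, and, for \<open>i < j\<close> and
  \<open>D = [t\<^sub>i, t\<^sub>j]\<close>, both \<open>s\<^sub>j D = - D\<close> and \<open>D = [e, t\<^sub>j] t\<^sub>j\<close> with \<open>e = s\<^sub>i \<dots> s\<^sub>j\<^sub>-\<^sub>1\<close>.

  If \<open>u\<close> is negated by left multiplication with \<open>s\<^sub>q, s\<^sub>q\<^sub>+\<^sub>2, \<dots>\<close> (\<open>k\<close> of them), then \<open>t\<^sub>q u\<close> is negated by
  \<open>s\<^sub>q\<^sub>+\<^sub>1, s\<^sub>q\<^sub>+\<^sub>3, \<dots>\<close>, since \<open>t\<^sub>q u = s\<^sub>q s\<^sub>q\<^sub>+\<^sub>1 t\<^sub>q\<^sub>+\<^sub>2 u\<close>. As \<open>[e, t\<^sub>j] = [e, s\<^sub>j t\<^sub>j\<^sub>+\<^sub>1]\<close>, applying this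
  for \<open>t\<^sub>j\<close> and then for \<open>t\<^sub>j\<^sub>+\<^sub>1\<close> shows that each further factor \<open>D\<close> adds one more \<open>s\<^sub>j\<^sub>+\<^sub>2\<^sub>k\<close> to those negating
  \<open>D\<^sup>k\<close>. Once the chain reaches \<open>s\<^sub>n\<^sub>-\<^sub>1\<close>, the corresponding \<open>t\<close> annihilates everything.
\<close>

section \<open>Powers of elements, and two identities for elements of the form
  \<open>1 + r T\<close>\<close>

context ring
begin

lemma pow_zero_mono:
  assumes "x \<in> carrier R" "x [^] (k::nat) = \<zero>" "k \<le> l"
  shows "x [^] l = \<zero>"
  using assms nat_pow_mult[of x k "l - k"] by simp

lemma uminus_pow_zero:
  assumes "x \<in> carrier R" "x [^] (k::nat) = \<zero>"
  shows "(\<ominus> x) [^] k = \<zero>"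
proof -
  have "(\<ominus> x) [^] k \<in> {x [^] k, \<ominus> (x [^] k)}" for k :: nat
    by (induction k) (use assms(1) in \<open>auto simp: l_minus r_minus\<close>)
  from this[of k] show ?thesis using assms by auto
qed

text \<open>With \<open>s\<close>, \<open>r\<close>, \<open>T\<close> standing for
  \<open>s p\<close>, \<open>s (p + 1)\<close>, \<open>t (p + 2)\<close>, the two factors are
  \<open>t (p + 1)\<close> and \<open>t p\<close>, and \<open>inv\<close> is the same relation one
  index higher. The product splits into \<open>1 + s\<close>, \<open>r T + s r T\<close> and
  \<open>r s Z\<close>. The first two are visibly fixed by \<open>s\<close>; the third is fixed
  because \<open>s r s Z = r s r Z\<close> and \<open>r Z = Z\<close> by \<open>inv\<close>.\<close>

lemma coxeter_step:
  assumes [simp]: "s \<in> carrier R" "r \<in> carrier R" "T \<in> carrier R"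
    and ss: "s \<otimes> s = \<one>"
    and braid: "s \<otimes> (r \<otimes> s) = r \<otimes> (s \<otimes> r)"
    and comm: "T \<otimes> s = s \<otimes> T"
    and inv: "r \<otimes> (T \<otimes> (\<one> \<oplus> r \<otimes> T)) = T \<otimes> (\<one> \<oplus> r \<otimes> T)"
  shows "s \<otimes> ((\<one> \<oplus> r \<otimes> T) \<otimes> (\<one> \<oplus> s \<otimes> (\<one> \<oplus> r \<otimes> T)))
    = (\<one> \<oplus> r \<otimes> T) \<otimes> (\<one> \<oplus> s \<otimes> (\<one> \<oplus> r \<otimes> T))"
proof -
  define Z where "Z = T \<otimes> (\<one> \<oplus> r \<otimes> T)"
  have [simp]: "Z \<in> carrier R" by (simp add: Z_def)
  have ss': "s \<otimes> (s \<otimes> x) = x" if "x \<in> carrier R" for x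
    using that ss by (simp flip: m_assoc)
  have comm': "T \<otimes> (s \<otimes> x) = s \<otimes> (T \<otimes> x)" if "x \<in> carrier R" for x
    using that comm by (simp flip: m_assoc)
  have braid': "s \<otimes> (r \<otimes> (s \<otimes> x)) = r \<otimes> (s \<otimes> (r \<otimes> x))" if "x \<in> carrier R" for x
    using that arg_cong[OF braid, of "\<lambda>y. y \<otimes> x"] by (simp add: m_assoc)
  have X: "(\<one> \<oplus> r \<otimes> T) \<otimes> (\<one> \<oplus> s \<otimes> (\<one> \<oplus> r \<otimes> T))
      = (\<one> \<oplus> s) \<oplus> ((r \<otimes> T \<oplus> s \<otimes> (r \<otimes> T)) \<oplus> r \<otimes> (s \<otimes> Z))"
    by (simp add: Z_def l_distr r_distr m_assoc comm comm' a_ac)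
  have "s \<otimes> (r \<otimes> (s \<otimes> Z)) = r \<otimes> (s \<otimes> Z)"
    using inv by (simp add: braid' flip: Z_def)
  then show ?thesis unfolding X by (simp add: r_distr ss ss' a_ac)
qed

text \<open>Meant for \<open>s (j - 1)\<close>, \<open>s j\<close>, \<open>t (j + 1)\<close>,
  \<open>t j\<close> as \<open>s\<close>, \<open>r\<close>, \<open>T\<close>, \<open>u\<close>. By
  \<open>inv\<close>, \<open>u u = u + T u\<close>, whereas \<open>u s u = s u + r s T u\<close>, so
  the terms \<open>s u\<close> cancel. The gain is the left factor \<open>1 - r\<close>, which an
  involution \<open>r\<close> negates.\<close>

lemma commutator_step:
  assumes [simp]: "s \<in> carrier R" "r \<in> carrier R" "T \<in> carrier R"
    and comm: "T \<otimes> s = s \<otimes> T"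
    and inv: "r \<otimes> (T \<otimes> (\<one> \<oplus> r \<otimes> T)) = T \<otimes> (\<one> \<oplus> r \<otimes> T)"
    and u: "u = \<one> \<oplus> r \<otimes> T"
  shows "(s \<otimes> u \<ominus> u \<otimes> s) \<otimes> u = (\<one> \<ominus> r) \<otimes> (s \<otimes> (T \<otimes> u))"
proof -
  have [simp]: "u \<in> carrier R" by (simp add: u)
  have comm': "T \<otimes> (s \<otimes> x) = s \<otimes> (T \<otimes> x)" if "x \<in> carrier R" for x
    using that comm by (simp flip: m_assoc)
  have rTu: "r \<otimes> (T \<otimes> u) = T \<otimes> u" using inv by (simp flip: u)
  have "u \<otimes> u = u \<oplus> T \<otimes> u"
    using rTu by (subst (1) u) (simp add: l_distr m_assoc)
  moreover have "u \<otimes> (s \<otimes> u) = s \<otimes> u \<oplus> r \<otimes> (s \<otimes> (T \<otimes> u))"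
    by (subst (1) u) (simp add: l_distr m_assoc comm')
  ultimately have "(s \<otimes> u \<ominus> u \<otimes> s) \<otimes> u
      = (s \<otimes> u \<oplus> s \<otimes> (T \<otimes> u)) \<ominus> (s \<otimes> u \<oplus> r \<otimes> (s \<otimes> (T \<otimes> u)))"
    by (simp add: minus_eq l_distr l_minus m_assoc r_distr)
  also have "\<dots> = s \<otimes> (T \<otimes> u) \<ominus> r \<otimes> (s \<otimes> (T \<otimes> u))"
    by (simp add: minus_eq minus_add a_ac r_neg2 r_neg1)
  also have "\<dots> = (\<one> \<ominus> r) \<otimes> (s \<otimes> (T \<otimes> u))"
    by (simp add: minus_eq l_distr l_minus)
  finally show ?thesis .
qed

end

section \<open>Abstract shuffles over the Coxeter generators, and centralizers of tails of the
  generators\<close>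

locale shuffle_ring = ring R for R (structure) +
  fixes n :: nat and s t :: "nat \<Rightarrow> 'a"
  assumes s_closed: "\<lbrakk>1 \<le> p; p < n\<rbrakk> \<Longrightarrow> s p \<in> carrier R"
    and s_square: "\<lbrakk>1 \<le> p; p < n\<rbrakk> \<Longrightarrow> s p \<otimes> s p = \<one>"
    and s_braid: "\<lbrakk>1 \<le> p; Suc p < n\<rbrakk> \<Longrightarrow> s p \<otimes> (s (Suc p) \<otimes> s p) = s (Suc p) \<otimes> (s p \<otimes> s (Suc p))"
    and s_commute: "\<lbrakk>1 \<le> p; p + 2 \<le> q; q < n\<rbrakk> \<Longrightarrow> s p \<otimes> s q = s q \<otimes> s p"
    and t_last: "t n = \<one>"
    and t_rec: "\<lbrakk>1 \<le> p; p < n\<rbrakk> \<Longrightarrow> t p = \<one> \<oplus> s p \<otimes> t (Suc p)"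
begin

text \<open>Stands in for explicit products of generators: what commutes with the tail
  \<open>s j\<close>, ..., \<open>s (n - 1)\<close> also commutes with every \<open>t q\<close>, j
  \<le> q \<le> n.\<close>

definition centr :: "nat \<Rightarrow> 'a set"
  where "centr j = {x \<in> carrier R. \<forall>p. j \<le> p \<and> p < n \<longrightarrow> x \<otimes> s p = s p \<otimes> x}"

lemma centr_closed: "x \<in> centr j \<Longrightarrow> x \<in> carrier R"
  by (simp add: centr_def)

lemma centr_s: "\<lbrakk>x \<in> centr j; j \<le> p; p < n\<rbrakk> \<Longrightarrow> x \<otimes> s p = s p \<otimes> x"
  by (simp add: centr_def)

lemma centr_one: "1 \<le> j \<Longrightarrow> \<one> \<in> centr j"
  by (simp add: centr_def s_closed)

lemma s_in_centr: "\<lbrakk>1 \<le> p; p < n; p + 2 \<le> j\<rbrakk> \<Longrightarrow> s p \<in> centr j"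
  by (auto simp: centr_def s_closed intro: s_commute)

lemma centr_add:
  assumes "1 \<le> j" "x \<in> centr j" "y \<in> centr j"
  shows "x \<oplus> y \<in> centr j"
  using assms by (auto simp: centr_def s_closed l_distr r_distr)

lemma centr_mult:
  assumes "1 \<le> j" "x \<in> centr j" "y \<in> centr j"
  shows "x \<otimes> y \<in> centr j"
proof -
  have "x \<otimes> y \<otimes> s p = s p \<otimes> (x \<otimes> y)" if "j \<le> p" "p < n" for p
  proof -
    have [simp]: "x \<in> carrier R" "y \<in> carrier R" "s p \<in> carrier R"
      using assms that by (auto simp: centr_closed s_closed)
    have "x \<otimes> y \<otimes> s p = x \<otimes> s p \<otimes> y"
      using centr_s[OF assms(3) that] by (simp add: m_assoc)
    then show ?thesis
      using centr_s[OF assms(2) that] by (simp add: m_assoc)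
  qed
  then show ?thesis using assms by (simp add: centr_def)
qed

lemma t_closed: "\<lbrakk>1 \<le> q; q \<le> n\<rbrakk> \<Longrightarrow> t q \<in> carrier R"
proof (induction "n - q" arbitrary: q)
  case 0
  then have q: "q = n" by simp
  show ?case unfolding q by (simp add: t_last)
next
  case (Suc k)
  then show ?case by (simp add: t_rec s_closed)
qed

lemma centr_t: "\<lbrakk>1 \<le> j; x \<in> centr j; j \<le> q; q \<le> n\<rbrakk> \<Longrightarrow> x \<otimes> t q = t q \<otimes> x"
proof (induction "n - q" arbitrary: q)
  case 0
  then have q: "q = n" by simp
  show ?case unfolding q using centr_closed[OF 0(3)] by (simp add: t_last)
next
  case (Suc k)
  then have [simp]: "x \<in> carrier R" "s q \<in> carrier R" "t (Suc q) \<in> carrier R"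
    by (auto simp: centr_closed s_closed t_closed)
  have IH: "x \<otimes> t (Suc q) = t (Suc q) \<otimes> x"
    using Suc by simp
  have "x \<otimes> s q = s q \<otimes> x"
    using Suc by (intro centr_s) auto
  then have "x \<otimes> (s q \<otimes> t (Suc q)) = s q \<otimes> (x \<otimes> t (Suc q))"
    by (simp flip: m_assoc)
  then show ?case
    using Suc IH by (simp add: t_rec l_distr r_distr m_assoc)
qed

section \<open>Relations between generators and shuffles, and the shape of the commutator\<close>

lemma s_t_commute: "\<lbrakk>1 \<le> p; p + 2 \<le> q; q \<le> n\<rbrakk> \<Longrightarrow> s p \<otimes> t q = t q \<otimes> s p"
  using s_in_centr[of p q] centr_t[of q "s p" q] by simp

text \<open>Downward induction starting at p = n - 1, where \<open>t n = 1\<close> and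
  \<open>s (1 + s) = 1 + s\<close> for an involution \<open>s\<close>; \<open>coxeter_step\<close>
  then lowers the index by one.\<close>

lemma s_t_t: "\<lbrakk>1 \<le> p; p < n\<rbrakk> \<Longrightarrow> s p \<otimes> (t (Suc p) \<otimes> t p) = t (Suc p) \<otimes> t p"
proof (induction "n - p" arbitrary: p)
  case 0
  then show ?case by simp
next
  case (Suc k)
  show ?case
  proof (cases "Suc p = n")
    case True
    then show ?thesis
      using Suc.prems s_closed[of p] by (simp add: t_rec t_last r_distr s_square a_comm)
  next
    case False
    then have p: "1 \<le> p" "Suc p < n" using Suc.prems by auto
    have "s (Suc p) \<otimes> (t (Suc (Suc p)) \<otimes> t (Suc p)) = t (Suc (Suc p)) \<otimes> t (Suc p)"
      using p Suc by (intro Suc.hyps) auto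
    then have "s (Suc p) \<otimes> (t (Suc (Suc p)) \<otimes> (\<one> \<oplus> s (Suc p) \<otimes> t (Suc (Suc p))))
        = t (Suc (Suc p)) \<otimes> (\<one> \<oplus> s (Suc p) \<otimes> t (Suc (Suc p)))"
      using p by (simp add: t_rec)
    from coxeter_step[OF _ _ _ s_square s_braid _ this]
    show ?thesis
      using p by (simp add: t_rec s_closed t_closed s_t_commute)
  qed
qed

text \<open>Unrolling \<open>t_rec\<close> from i down to \<open>t j\<close> gives
  \<open>b = 1 + s i + ... + s i ... s (j - 2)\<close> and \<open>c = s i ... s (j - 2)\<close>.
  Only indices up to j - 2 occur, so both commute with \<open>s j\<close> and all later
  generators.\<close>

lemma t_decompose:
  assumes "1 \<le> i" "i < j" "j \<le> n"
  shows "\<exists>b\<in>centr j. \<exists>c\<in>centr j. t i = b \<oplus> c \<otimes> (s (j - 1) \<otimes> t j)"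
  using assms
proof (induction "j - i" arbitrary: i)
  case 0
  then show ?case by simp
next
  case (Suc k)
  have [simp]: "s (j - Suc 0) \<in> carrier R" "t j \<in> carrier R"
    using Suc.prems by (auto simp: s_closed t_closed)
  show ?case
  proof (cases "i = j - 1")
    case True
    with Suc.prems show ?thesis
      by (intro bexI[of _ \<one>]) (auto simp: t_rec centr_one)
  next
    case False
    then have "k = j - Suc i" "Suc i < j"
      using Suc.hyps(2) Suc.prems by linarith+
    then obtain b c where bc: "b \<in> centr j" "c \<in> centr j"
      "t (Suc i) = b \<oplus> c \<otimes> (s (j - 1) \<otimes> t j)"
      using Suc.hyps(1)[of "Suc i"] Suc.prems by auto
    have si: "s i \<in> centr j"
      using False Suc.prems by (intro s_in_centr) auto
    have [simp]: "b \<in> carrier R" "c \<in> carrier R" "s i \<in> carrier R"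
      using bc si by (auto simp: centr_closed)
    have "t i = (\<one> \<oplus> s i \<otimes> b) \<oplus> (s i \<otimes> c) \<otimes> (s (j - 1) \<otimes> t j)"
      using Suc.prems bc(3) by (simp add: t_rec r_distr m_assoc a_assoc)
    moreover have "\<one> \<oplus> s i \<otimes> b \<in> centr j" "s i \<otimes> c \<in> centr j"
      using bc si Suc.prems by (auto intro!: centr_add centr_mult centr_one)
    ultimately show ?thesis by blast
  qed
qed

text \<open>In the decomposition of \<open>t i\<close>, the term \<open>b\<close> commutes with
  \<open>t j\<close> and drops out, and \<open>c\<close> can be pulled to the left; this leaves
  \<open>c [s (j - 1), t j] t j\<close>, so \<open>e = c s (j - 1)\<close>. The sign comes from the
  factor \<open>1 - s j\<close> of \<open>commutator_step\<close>, since \<open>c\<close> commutes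
  with \<open>s j\<close>.\<close>

lemma commutator_t:
  assumes "1 \<le> i" "i < j" "j \<le> n"
  obtains e where "e \<in> centr (Suc j)"
    "ring_commutator R (t i) (t j) = (e \<otimes> t j \<ominus> t j \<otimes> e) \<otimes> t j"
    "j < n \<Longrightarrow> s j \<otimes> ring_commutator R (t i) (t j) = \<ominus> ring_commutator R (t i) (t j)"
proof -
  obtain b c where bc: "b \<in> centr j" "c \<in> centr j" "t i = b \<oplus> c \<otimes> (s (j - 1) \<otimes> t j)"
    using t_decompose[OF assms] by blast
  have cl[simp]: "b \<in> carrier R" "c \<in> carrier R" "s (j - Suc 0) \<in> carrier R" "t j \<in> carrier R"
    using bc assms by (auto simp: centr_closed s_closed t_closed)
  have b: "b \<otimes> t j = t j \<otimes> b" and c: "c \<otimes> t j = t j \<otimes> c"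
    using bc assms centr_t[of j b j] centr_t[of j c j] by auto
  have c': "t j \<otimes> (c \<otimes> x) = c \<otimes> (t j \<otimes> x)" if "x \<in> carrier R" for x
    using that c by (simp flip: m_assoc)
  define D where "D = ring_commutator R (t i) (t j)"
  have D1: "D = c \<otimes> ((s (j - 1) \<otimes> t j \<ominus> t j \<otimes> s (j - 1)) \<otimes> t j)"
    unfolding D_def ring_commutator_def bc(3)
    by (simp add: l_distr r_distr m_assoc b c' minus_eq minus_add l_minus r_minus a_ac r_neg1 r_neg2)
  let ?e = "c \<otimes> s (j - 1)"
  have "c \<in> centr (Suc j)" using bc by (simp add: centr_def)
  then have e: "?e \<in> centr (Suc j)"
    using assms by (intro centr_mult s_in_centr) auto
  have D2: "D = (?e \<otimes> t j \<ominus> t j \<otimes> ?e) \<otimes> t j"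
    unfolding D1 by (simp add: l_distr r_distr m_assoc c' minus_eq l_minus r_minus)
  have "s j \<otimes> D = \<ominus> D" if j: "j < n"
  proof -
    have cl'[simp]: "s j \<in> carrier R" "t (Suc j) \<in> carrier R"
      using j assms by (auto simp: s_closed t_closed)
    have tj: "t j = \<one> \<oplus> s j \<otimes> t (Suc j)"
      using j assms by (simp add: t_rec)
    have "(s (j - 1) \<otimes> t j \<ominus> t j \<otimes> s (j - 1)) \<otimes> t j
        = (\<one> \<ominus> s j) \<otimes> (s (j - 1) \<otimes> (t (Suc j) \<otimes> t j))"
    proof (rule commutator_step[OF cl(3)[folded One_nat_def] cl' _ _ tj])
      show "t (Suc j) \<otimes> s (j - 1) = s (j - 1) \<otimes> t (Suc j)"
        using assms j by (simp add: s_t_commute)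
      show "s j \<otimes> (t (Suc j) \<otimes> (\<one> \<oplus> s j \<otimes> t (Suc j)))
          = t (Suc j) \<otimes> (\<one> \<oplus> s j \<otimes> t (Suc j))"
        using s_t_t[of j] assms j by (simp flip: tj)
    qed
    then have D3: "D = c \<otimes> ((\<one> \<ominus> s j) \<otimes> (s (j - 1) \<otimes> (t (Suc j) \<otimes> t j)))"
      by (simp add: D1)
    have "c \<otimes> s j = s j \<otimes> c" using bc j by (intro centr_s) auto
    then have cs: "s j \<otimes> (c \<otimes> x) = c \<otimes> (s j \<otimes> x)" if "x \<in> carrier R" for x
      using that by (simp flip: m_assoc)
    have "s j \<otimes> (s j \<otimes> x) = x" if "x \<in> carrier R" for x
      using that s_square[of j] assms j by (simp flip: m_assoc)
    then show ?thesis
      unfolding D3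
      by (simp add: cs l_distr r_distr minus_eq l_minus r_minus minus_add a_comm)
  qed
  then show thesis using that[OF e] D2 by (simp add: D_def)
qed

section \<open>Chains of commuting generators that act by -1\<close>

text \<open>The last index is q + 2 (k - 1), so the chain stays among the generators up to
  \<open>s (n - 1)\<close> exactly when q + 2 k \<le> n + 1 (for k > 0).\<close>

definition alternating :: "nat \<Rightarrow> nat \<Rightarrow> 'a \<Rightarrow> bool"
  where "alternating q k u \<longleftrightarrow> (\<forall>l<k. s (q + 2 * l) \<otimes> u = \<ominus> u)"

lemma alternating_Suc:
  "alternating q (Suc k) u \<longleftrightarrow> s q \<otimes> u = \<ominus> u \<and> alternating (q + 2) k u"
  unfolding alternating_def by (simp add: All_less_Suc2 algebra_simps)

lemma alternating_mult:
  assumes "u \<in> carrier R" "x \<in> centr q" "1 \<le> q" "q + 2 * k \<le> Suc n" "alternating q k u"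
  shows "alternating q k (x \<otimes> u)"
  unfolding alternating_def
proof (intro allI impI)
  fix l assume l: "l < k"
  then have p: "s (q + 2 * l) \<in> carrier R" "x \<in> carrier R"
    using assms by (auto simp: s_closed centr_closed)
  have "s (q + 2 * l) \<otimes> (x \<otimes> u) = x \<otimes> (s (q + 2 * l) \<otimes> u)"
    using centr_s[OF assms(2), of "q + 2 * l"] assms l p by (simp flip: m_assoc)
  then show "s (q + 2 * l) \<otimes> (x \<otimes> u) = \<ominus> (x \<otimes> u)"
    using assms l p by (simp add: alternating_def r_minus)
qed

text \<open>Two applications of \<open>t_rec\<close> give
  \<open>u + s q u + s q s (q + 1) t (q + 2) u\<close>, and the first two terms cancel.\<close>

lemma t_two_steps:
  assumes "u \<in> carrier R" "1 \<le> q" "q + 2 \<le> n" "s q \<otimes> u = \<ominus> u"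
  shows "t q \<otimes> u = s q \<otimes> (s (Suc q) \<otimes> (t (q + 2) \<otimes> u))"
proof -
  have [simp]: "s q \<in> carrier R" "s (Suc q) \<in> carrier R" "t (Suc (Suc q)) \<in> carrier R"
    using assms by (auto simp: s_closed t_closed)
  show ?thesis
    using assms by (simp add: t_rec l_distr r_distr m_assoc r_neg1 flip: a_assoc) (simp add: r_neg)
qed

text \<open>For \<open>v = t (q + 2) u\<close>, \<open>t_two_steps\<close> gives
  \<open>t q u = s q s (q + 1) v\<close>, and \<open>s q\<close> negates \<open>v\<close> because it
  commutes with \<open>t (q + 2)\<close>. The braid relation turns this into negation of
  \<open>t q u\<close> by \<open>s (q + 1)\<close>.\<close>

lemma alternating_t:
  "\<lbrakk>u \<in> carrier R; 1 \<le> q; q + 2 * k \<le> n; alternating q k u\<rbrakk> \<Longrightarrow> alternating (Suc q) k (t q \<otimes> u)"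
proof (induction k arbitrary: q)
  case 0
  then show ?case by (simp add: alternating_def)
next
  case (Suc k)
  then have u: "s q \<otimes> u = \<ominus> u" "alternating (q + 2) k u"
    by (auto simp: alternating_Suc)
  define v where "v = t (q + 2) \<otimes> u"
  have [simp]: "s q \<in> carrier R" "s (Suc q) \<in> carrier R" "t (Suc (Suc q)) \<in> carrier R"
    "u \<in> carrier R" "v \<in> carrier R"
    using Suc.prems by (auto simp: s_closed t_closed v_def)
  have tu: "t q \<otimes> u = s q \<otimes> (s (Suc q) \<otimes> v)"
    unfolding v_def using Suc.prems u by (intro t_two_steps) auto
  have "s q \<otimes> v = t (q + 2) \<otimes> (s q \<otimes> u)"
    using s_t_commute[of q "q + 2"] Suc.prems by (simp add: v_def flip: m_assoc)
  then have sv: "s q \<otimes> v = \<ominus> v"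
    by (simp add: u v_def r_minus)
  have "s (Suc q) \<otimes> (s q \<otimes> (s (Suc q) \<otimes> v)) = s q \<otimes> (s (Suc q) \<otimes> (s q \<otimes> v))"
    using arg_cong[OF s_braid[of q], of "\<lambda>x. x \<otimes> v"] Suc.prems by (simp add: m_assoc)
  then have 1: "s (Suc q) \<otimes> (t q \<otimes> u) = \<ominus> (t q \<otimes> u)"
    by (simp add: tu sv r_minus)
  \<comment> \<open>The rest of the chain is shifted by induction; \<open>s q\<close> and
    \<open>s (q + 1)\<close> commute with the generators from index q + 3 on, so prefixing them to
    \<open>v\<close> keeps the signs.\<close>
  have "alternating (q + 3) k v"
    using Suc.IH[of "q + 2"] Suc.prems u by (simp add: v_def numeral_eq_Suc)
  then have "alternating (q + 3) k (s q \<otimes> (s (Suc q) \<otimes> v))"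
    using Suc.prems
    by (cases k) (auto simp: alternating_def[of _ 0] intro!: alternating_mult s_in_centr)
  then show ?case
    using 1 by (simp add: alternating_Suc tu numeral_eq_Suc)
qed

text \<open>The condition on n makes the chain end at \<open>s (n - 1)\<close>.
  \<open>t_two_steps\<close> peels off generators in pairs until
  \<open>t (n - 1) u = u + s (n - 1) u = 0\<close> remains.\<close>

lemma t_annihilates:
  "\<lbrakk>u \<in> carrier R; 1 \<le> q; n = Suc (q + 2 * k); alternating q (Suc k) u\<rbrakk> \<Longrightarrow> t q \<otimes> u = \<zero>"
proof (induction k arbitrary: q)
  case 0
  then show ?case
    using s_closed[of q] t_last by (simp add: t_rec alternating_def l_distr r_neg)
next
  case (Suc k)
  then have "t (q + 2) \<otimes> u = \<zero>"
    by (intro Suc.IH) (auto simp: alternating_Suc[of q])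
  moreover have "t q \<otimes> u = s q \<otimes> (s (Suc q) \<otimes> (t (q + 2) \<otimes> u))"
    using Suc.prems by (intro t_two_steps) (auto simp: alternating_Suc[of q])
  ultimately show ?case using Suc.prems by (simp add: s_closed)
qed

section \<open>Powers of the commutator and their vanishing\<close>

text \<open>The summand 1 of \<open>t j\<close> cancels in the commutator. What is left exposes
  \<open>t (j + 1)\<close>, so that a chain can be shifted a second time.\<close>

lemma commutator_mult:
  assumes "1 \<le> j" "j < n" "e \<in> centr (Suc j)" "v \<in> carrier R"
  shows "(e \<otimes> t j \<ominus> t j \<otimes> e) \<otimes> v = e \<otimes> (s j \<otimes> (t (Suc j) \<otimes> v)) \<ominus> s j \<otimes> (t (Suc j) \<otimes> (e \<otimes> v))"
proof -
  have [simp]: "e \<in> carrier R" "s j \<in> carrier R" "t (Suc j) \<in> carrier R" "v \<in> carrier R"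
    using assms by (auto simp: s_closed t_closed centr_closed)
  show ?thesis
    using assms
    by (simp add: t_rec l_distr r_distr m_assoc minus_eq minus_add l_minus r_minus a_ac r_neg1 r_neg2)
qed

lemma alternating_minus:
  assumes "x \<in> carrier R" "y \<in> carrier R" "1 \<le> q" "q + 2 * k \<le> Suc n"
    "alternating q k x" "alternating q k y"
  shows "alternating q k (x \<ominus> y)"
proof -
  have "s (q + 2 * l) \<in> carrier R" if "l < k" for l
    using assms that by (intro s_closed) auto
  then show ?thesis
    using assms by (auto simp: alternating_def minus_eq r_distr r_minus minus_add)
qed

text \<open>The first generator \<open>s j\<close> is the sign relation of
  \<open>commutator_t\<close>. The old chain moves from j to j + 1 under \<open>t j\<close> and on
  to j + 2 under \<open>t (j + 1)\<close>, making room for it.\<close>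

lemma alternating_commutator:
  assumes "1 \<le> i" "i < j" "u \<in> carrier R" "j + 2 * k < n" "alternating j k u"
  shows "alternating j (Suc k) (ring_commutator R (t i) (t j) \<otimes> u)"
proof -
  obtain e where e: "e \<in> centr (Suc j)"
    "ring_commutator R (t i) (t j) = (e \<otimes> t j \<ominus> t j \<otimes> e) \<otimes> t j"
    "s j \<otimes> ring_commutator R (t i) (t j) = \<ominus> ring_commutator R (t i) (t j)"
    using commutator_t[of i j] assms by auto
  define v where "v = t j \<otimes> u"
  have [simp]: "e \<in> carrier R" "s j \<in> carrier R" "t j \<in> carrier R" "t (Suc j) \<in> carrier R"
    "u \<in> carrier R" "v \<in> carrier R"
    using assms e by (auto simp: s_closed t_closed centr_closed v_def)
  have D: "ring_commutator R (t i) (t j) \<in> carrier R" by (simp add: e(2))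
  have "s j \<otimes> (ring_commutator R (t i) (t j) \<otimes> u) = \<ominus> (ring_commutator R (t i) (t j) \<otimes> u)"
    using D e(3) by (simp add: l_minus flip: m_assoc)
  moreover have "alternating (j + 2) k (ring_commutator R (t i) (t j) \<otimes> u)"
  proof -
    have e': "e \<in> centr (j + 2)" using e(1) by (simp add: centr_def)
    have v: "alternating (Suc j) k v"
      unfolding v_def using assms by (intro alternating_t) auto
    moreover have "alternating (Suc j) k (e \<otimes> v)"
      using assms e v by (intro alternating_mult) auto
    ultimately have "alternating (j + 2) k (t (Suc j) \<otimes> v)"
      "alternating (j + 2) k (t (Suc j) \<otimes> (e \<otimes> v))"
      using alternating_t[of v "Suc j" k] alternating_t[of "e \<otimes> v" "Suc j" k] assms
      by (auto simp: numeral_eq_Suc)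
    \<comment> \<open>Both \<open>e\<close> and \<open>s j\<close> commute with the generators from
      index j + 2 on.\<close>
    then have "alternating (j + 2) k
        (e \<otimes> (s j \<otimes> (t (Suc j) \<otimes> v)) \<ominus> s j \<otimes> (t (Suc j) \<otimes> (e \<otimes> v)))"
      using assms e' by (intro alternating_minus alternating_mult[of _ e] alternating_mult[of _ "s j"] s_in_centr) auto
    moreover have "ring_commutator R (t i) (t j) \<otimes> u = (e \<otimes> t j \<ominus> t j \<otimes> e) \<otimes> v"
      by (simp add: e(2) v_def m_assoc)
    ultimately show ?thesis
      using commutator_mult[of j e v] e assms by simp
  qed
  ultimately show ?thesis by (simp add: alternating_Suc)
qed

lemma commutator_closed:
  "\<lbrakk>1 \<le> i; i \<le> n; 1 \<le> j; j \<le> n\<rbrakk> \<Longrightarrow> ring_commutator R (t i) (t j) \<in> carrier R"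
  by (simp add: ring_commutator_def t_closed)

lemma alternating_commutator_pow:
  assumes "1 \<le> i" "i < j" "j + 2 * k \<le> Suc n" "j \<le> n"
  shows "alternating j k (ring_commutator R (t i) (t j) [^] k)"
  using assms(3)
proof (induction k)
  case 0
  then show ?case by (simp add: alternating_def)
next
  case (Suc k)
  have "ring_commutator R (t i) (t j) \<in> carrier R"
    using assms by (intro commutator_closed) auto
  moreover from this have "alternating j (Suc k)
      (ring_commutator R (t i) (t j) \<otimes> ring_commutator R (t i) (t j) [^] k)"
    using Suc assms by (intro alternating_commutator) auto
  \<comment> \<open>The new factor enters on the left, while the recursion for powers appends it on
    the right.\<close>
  ultimately show ?case by (simp only: nat_pow_Suc2)
qed

text \<open>The two bounds pin m to the ceiling of (n - j) / 2. Then \<open>D [^] m\<close> carries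
  a chain of length m starting at j, and the parity of n - j decides whether \<open>t j\<close> or
  \<open>t (j + 1)\<close> kills it in the next factor \<open>D\<close>.\<close>

lemma commutator_pow_zero:
  assumes ij: "1 \<le> i" "i < j" "j \<le> n" and m: "n \<le> j + 2 * m" "j + 2 * m \<le> Suc n"
  shows "ring_commutator R (t i) (t j) [^] Suc m = \<zero>"
proof -
  obtain e where e: "e \<in> centr (Suc j)"
    "ring_commutator R (t i) (t j) = (e \<otimes> t j \<ominus> t j \<otimes> e) \<otimes> t j"
    using commutator_t[of i j] assms by auto
  define D where "D = ring_commutator R (t i) (t j)"
  define u where "u = D [^] m"
  define v where "v = t j \<otimes> u"
  have [simp]: "D \<in> carrier R"
    using assms by (auto simp: D_def intro: commutator_closed)
  have [simp]: "e \<in> carrier R" "t j \<in> carrier R" "u \<in> carrier R" "v \<in> carrier R"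
    using assms e by (auto simp: t_closed centr_closed v_def u_def)
  have u: "alternating j m u"
    unfolding u_def D_def using assms by (intro alternating_commutator_pow) auto
  have Du: "D \<otimes> u = (e \<otimes> t j \<ominus> t j \<otimes> e) \<otimes> v"
    by (simp add: D_def e(2) v_def m_assoc)
  consider "j = n" | k where "m = Suc k" "n = Suc (j + 2 * k)" | k where "m = Suc k" "n = j + 2 * m"
  proof -
    have "j = n \<or> n = Suc (j + 2 * (m - 1)) \<and> m = Suc (m - 1) \<or> n = j + 2 * m \<and> m = Suc (m - 1)"
      using assms by linarith
    then show thesis using that by blast
  qed
  then have "D \<otimes> u = \<zero>"
  proof cases
    case 1
    then show ?thesis unfolding Du by (simp add: t_last minus_eq r_neg)
  next
    \<comment> \<open>Here n - j is odd and the chain already ends at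
      \<open>s (n - 1)\<close>.\<close>
    case 2
    then have "v = \<zero>"
      unfolding v_def using u ij by (intro t_annihilates[of u j k]) auto
    then show ?thesis unfolding Du by simp
  next
    \<comment> \<open>Here n - j is even and positive, and the chain ends at
      \<open>s (n - 2)\<close>. One shift by \<open>t j\<close> moves its end to
      \<open>s (n - 1)\<close>, after which \<open>t (j + 1)\<close> annihilates both terms of
      \<open>commutator_mult\<close>.\<close>
    case 3
    have v: "alternating (Suc j) m v"
      unfolding v_def using assms 3 u by (intro alternating_t) auto
    moreover have "alternating (Suc j) m (e \<otimes> v)"
      using 3 e v by (intro alternating_mult) auto
    ultimately have "t (Suc j) \<otimes> v = \<zero>" "t (Suc j) \<otimes> (e \<otimes> v) = \<zero>"
      using t_annihilates[of v "Suc j" k] t_annihilates[of "e \<otimes> v" "Suc j" k] 3 by auto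
    moreover have "s j \<in> carrier R" using 3 ij by (intro s_closed) auto
    ultimately show ?thesis
      unfolding Du using commutator_mult[of j e v] e ij 3 by (simp add: minus_eq)
  qed
  then show ?thesis
    using nat_pow_Suc2[of D m] by (simp only: u_def D_def[symmetric] \<open>D \<in> carrier R\<close>)
qed

theorem commutator_nilpotent:
  assumes "i \<in> {1..n}" "j \<in> {1..n}" and m: "n \<le> j + 2 * m"
  shows "ring_commutator R (t i) (t j) [^] Suc m = \<zero>"
proof -
  have *: "ring_commutator R (t a) (t b) [^] Suc m = \<zero>"
    if "1 \<le> a" "a < b" "b \<le> n" "n \<le> b + 2 * m" for a b
  proof -
    \<comment> \<open>This is the ceiling of (n - b) / 2, the least admissible exponent minus one; m
      is at least as large.\<close>
    let ?k = "(Suc n - b) div 2"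
    have "ring_commutator R (t a) (t b) [^] Suc ?k = \<zero>"
      using that by (intro commutator_pow_zero) auto
    then show ?thesis
      by (rule pow_zero_mono[rotated]) (use that in \<open>auto intro: commutator_closed\<close>)
  qed
  have cl: "t i \<in> carrier R" "t j \<in> carrier R" using assms by (auto intro: t_closed)
  consider "i < j" | "i = j" | "j < i" by linarith
  then show ?thesis
  proof cases
    case 1
    then show ?thesis using * assms by auto
  next
    case 2
    then show ?thesis using cl by (simp add: ring_commutator_def minus_eq r_neg)
  next
    case 3
    have "ring_commutator R (t i) (t j) = \<ominus> ring_commutator R (t j) (t i)"
      using cl by (simp add: ring_commutator_def minus_eq minus_add a_comm)
    \<comment> \<open>The larger index is now i, and n \<le> i + 2 m follows from j < i.\<close>
    then show ?thesis
      using uminus_pow_zero[OF commutator_closed *[of j i]] 3 assms by auto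
  qed
qed

end

section \<open>The group algebra of the symmetric group as an instance\<close>

lemma group_ring_of_closed:
  assumes "ring R"
  shows "group_ring_of R G x \<in> carrier (group_ring R G)"
proof -
  interpret ring R by fact
  show ?thesis by (auto simp: group_ring_of_def group_ring_def)
qed

lemma group_ring_of_one: "group_ring_of R G \<one>\<^bsub>G\<^esub> = \<one>\<^bsub>group_ring R G\<^esub>"
  by (simp add: group_ring_of_def group_ring_def)

lemma group_ring_of_mult:
  assumes "ring R" "group G" "finite (carrier G)" "x \<in> carrier G" "y \<in> carrier G"
  shows "group_ring_of R G x \<otimes>\<^bsub>group_ring R G\<^esub> group_ring_of R G y = group_ring_of R G (x \<otimes>\<^bsub>G\<^esub> y)"
proof -
  interpret R: ring R by fact
  interpret G: group G by fact
  have "(\<Oplus>\<^bsub>R\<^esub>h\<in>carrier G. group_ring_of R G x h \<otimes>\<^bsub>R\<^esub> group_ring_of R G y (inv\<^bsub>G\<^esub> h \<otimes>\<^bsub>G\<^esub> g))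
      = (if g = x \<otimes>\<^bsub>G\<^esub> y then \<one>\<^bsub>R\<^esub> else \<zero>\<^bsub>R\<^esub>)" (is "?l = ?r") if g: "g \<in> carrier G" for g
  proof -
    have eq: "inv\<^bsub>G\<^esub> x \<otimes>\<^bsub>G\<^esub> g = y \<longleftrightarrow> g = x \<otimes>\<^bsub>G\<^esub> y"
      using assms g by (metis G.inv_solve_left G.inv_closed G.m_closed)
    \<comment> \<open>In a convolution of two point masses only h = x can contribute.\<close>
    have "?l = (\<Oplus>\<^bsub>R\<^esub>h\<in>carrier G. if x = h then ?r else \<zero>\<^bsub>R\<^esub>)"
      using assms g eq by (intro R.finsum_cong') (auto simp: group_ring_of_def)
    also have "\<dots> = ?r"
      using assms g by (subst R.add.finprod_singleton) auto
    finally show ?thesis .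
  qed
  then show ?thesis
    by (auto simp: group_ring_def group_ring_of_def cong: restrict_cong)
qed

lemma finite_sym_group: "finite (carrier (sym_group n))"
  by (simp add: sym_group_def finite_permutations)

lemma transpose_in_sym_group:
  "\<lbrakk>1 \<le> p; p < n\<rbrakk> \<Longrightarrow> transpose p (Suc p) \<in> carrier (sym_group n)"
  by (auto simp: sym_group_carrier intro: permutes_swap_id)

lemma cycle_in_sym_group:
  assumes "1 \<le> l" "m \<le> n"
  shows "cycle_of_list [l..<Suc m] \<in> carrier (sym_group n)"
  unfolding sym_group_carrier
  by (rule permutes_subset[OF cycle_permutes]) (use assms in auto)

text \<open>The source of the recursion \<open>t_rec\<close>: every nontrivial cycle in
  \<open>t l\<close> has the same left factor.\<close>

lemma cycle_of_list_upt:
  "l < m \<Longrightarrow> cycle_of_list [l..<Suc m] = transpose l (Suc l) \<circ> cycle_of_list [Suc l..<Suc m]"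
  by (simp add: upt_conv_Cons del: upt_Suc)

lemma shuffle_ring_sym_group:
  assumes "ring R"
  shows "shuffle_ring (group_ring R (sym_group n)) n
    (\<lambda>p. group_ring_of R (sym_group n) (transpose p (Suc p))) (somewhere_to_below R n)"
proof -
  interpret R: ring R by fact
  let ?G = "sym_group n" and ?A = "group_ring R (sym_group n)"
  let ?d = "group_ring_of R (sym_group n)"
  have G: "group ?G" by (rule sym_group_is_group)
  interpret A: ring ?A by (rule ring_group_ring[OF assms G finite_sym_group])
  have d: "?d x \<in> carrier ?A" for x by (rule group_ring_of_closed[OF assms])
  have mult: "?d x \<otimes>\<^bsub>?A\<^esub> ?d y = ?d (x \<circ> y)"
    if "x \<in> carrier ?G" "y \<in> carrier ?G" for x y
    using group_ring_of_mult[OF assms G finite_sym_group that] by (simp add: sym_group_mult)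
  have comp: "x \<circ> y \<in> carrier ?G" if "x \<in> carrier ?G" "y \<in> carrier ?G" for x y
    using group.is_monoid[OF G] that monoid.m_closed[of ?G x y] by (simp add: sym_group_mult)
  have id: "?d id = \<one>\<^bsub>?A\<^esub>"
    using group_ring_of_one[of R ?G] by (simp add: sym_group_one)
  note tr = transpose_in_sym_group
  show ?thesis
  proof unfold_locales
    fix p assume p: "1 \<le> p" "p < n"
    show "?d (transpose p (Suc p)) \<in> carrier ?A" by (rule d)
    show "?d (transpose p (Suc p)) \<otimes>\<^bsub>?A\<^esub> ?d (transpose p (Suc p)) = \<one>\<^bsub>?A\<^esub>"
      using p by (simp add: mult tr id)
    \<comment> \<open>The summand m = p is a cycle of length one, hence the unit; the transposition
      factors out of all the others.\<close>
    have "somewhere_to_below R n p = (\<Oplus>\<^bsub>?A\<^esub>m\<in>insert p {Suc p..n}. ?d (cycle_of_list [p..<Suc m]))"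
      using p by (simp add: somewhere_to_below_def atLeastAtMost_insertL del: upt_Suc)
    also have "\<dots> = \<one>\<^bsub>?A\<^esub> \<oplus>\<^bsub>?A\<^esub> (\<Oplus>\<^bsub>?A\<^esub>m\<in>{Suc p..n}. ?d (cycle_of_list [p..<Suc m]))"
      by (subst A.finsum_insert) (auto simp: d id simp del: upt_Suc, simp add: id)
    also have "(\<Oplus>\<^bsub>?A\<^esub>m\<in>{Suc p..n}. ?d (cycle_of_list [p..<Suc m]))
        = (\<Oplus>\<^bsub>?A\<^esub>m\<in>{Suc p..n}. ?d (transpose p (Suc p)) \<otimes>\<^bsub>?A\<^esub> ?d (cycle_of_list [Suc p..<Suc m]))"
      by (rule A.finsum_cong')
        (use p in \<open>auto simp: d mult tr cycle_in_sym_group cycle_of_list_upt simp del: upt_Suc\<close>)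
    also have "\<dots> = ?d (transpose p (Suc p)) \<otimes>\<^bsub>?A\<^esub> somewhere_to_below R n (Suc p)"
      unfolding somewhere_to_below_def by (subst A.finsum_rdistr) (auto simp: d)
    finally show "somewhere_to_below R n p = \<one>\<^bsub>?A\<^esub> \<oplus>\<^bsub>?A\<^esub> ?d (transpose p (Suc p)) \<otimes>\<^bsub>?A\<^esub> somewhere_to_below R n (Suc p)" .
  next
    fix p assume p: "1 \<le> p" "Suc p < n"
    have "transpose p (Suc p) \<circ> (transpose (Suc p) (Suc (Suc p)) \<circ> transpose p (Suc p))
        = transpose (Suc p) (Suc (Suc p)) \<circ> (transpose p (Suc p) \<circ> transpose (Suc p) (Suc (Suc p)))"
      by (auto simp: fun_eq_iff transpose_def)
    then show "?d (transpose p (Suc p)) \<otimes>\<^bsub>?A\<^esub> (?d (transpose (Suc p) (Suc (Suc p))) \<otimes>\<^bsub>?A\<^esub> ?d (transpose p (Suc p)))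
      = ?d (transpose (Suc p) (Suc (Suc p))) \<otimes>\<^bsub>?A\<^esub> (?d (transpose p (Suc p)) \<otimes>\<^bsub>?A\<^esub> ?d (transpose (Suc p) (Suc (Suc p))))"
      using p by (simp add: mult comp tr)
  next
    fix p q assume pq: "1 \<le> p" "p + 2 \<le> q" "q < n"
    have "transpose p (Suc p) \<circ> transpose q (Suc q) = transpose q (Suc q) \<circ> transpose p (Suc p)"
      using pq by (auto simp: fun_eq_iff transpose_def)
    then show "?d (transpose p (Suc p)) \<otimes>\<^bsub>?A\<^esub> ?d (transpose q (Suc q))
      = ?d (transpose q (Suc q)) \<otimes>\<^bsub>?A\<^esub> ?d (transpose p (Suc p))"
      using pq by (simp add: mult tr)
  next
    show "somewhere_to_below R n n = \<one>\<^bsub>?A\<^esub>"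
      by (simp add: somewhere_to_below_def d id A.finsum_insert[of "{}" n, simplified])
  qed
qed

theorem corollary8p18:
  fixes R :: "('k, 'r) ring_scheme" and n i j :: nat
  assumes "cring R"
    and "i \<in> {1..n}" and "j \<in> {1..n}"
  shows "ring_commutator (group_ring R (sym_group n))
           (somewhere_to_below R n i) (somewhere_to_below R n j)
         [^]\<^bsub>group_ring R (sym_group n)\<^esub> (nat \<lceil>(real n - real j) / 2\<rceil> + 1)
         = \<zero>\<^bsub>group_ring R (sym_group n)\<^esub>"
proof -
  interpret shuffle_ring "group_ring R (sym_group n)" n
    "\<lambda>p. group_ring_of R (sym_group n) (transpose p (Suc p))" "somewhere_to_below R n"
    using assms(1) by (intro shuffle_ring_sym_group) (simp add: cring_def)
  \<comment> \<open>The ceiling enters through the fact that it is at least (n - j) / 2, restated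
    here over the naturals.\<close>
  have "n \<le> j + 2 * m" if "(real n - real j) / 2 \<le> real m" for m
  proof -
    have "real n \<le> real (j + 2 * m)" using that by (simp add: field_simps)
    then show ?thesis by (simp only: of_nat_le_iff)
  qed
  from commutator_nilpotent[OF assms(2,3) this[OF real_nat_ceiling_ge]] show ?thesis by simp
qed

end
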